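(* Let $X$ be a finite dimensional Banach space. Then: (i) $\mathcal{A}_{\|\cdot\|}(X,Y)=\{T\in\mathcal{L}(X,Y): \|T\|=1\}$ for any Banach space $Y$; (ii) $\mathcal{A}_{\mathrm{nu}}(X)=\{T\in\mathcal{L}(X): \nu(T)=1\}$. Moreover, (iii) every norm one functional on $c_0$ which attains its norm belongs to $\mathcal{A}_{\|\cdot\|}(c_0,\mathbb{K})$.
   Context: Banach spaces are over $\mathbb{K}=\mathbb{R}$ or $\mathbb{C}$; $S_X$ is the unit sphere of $X$, $X^*$ the topological dual, $\mathcal{L}(X,Y)$ the bounded linear operators from $X$ to $Y$, $\mathcal{L}(X)=\mathcal{L}(X,X)$, and $\langle x^*,x\rangle=x^*(x)$. An operator $T\in\mathcal{L}(X,Y)$ attains its norm if $\|T(x_0)\|=\|T\|$ for some $x_0\in S_X$. Let $\Pi(X)=\{(x,x^* )\in S_X\times S_{X^*}:\langle x^*,x\rangle=1\}$ and, for $T\in\mathcal{L}(X)$, $\nu(T)=\sup\{|\langle x^*,T(x)\rangle|:(x,x^* )\in\Pi(X)\}$; $T$ attains its numerical radius if this supremum is attained. $\mathcal{A}_{\|\cdot\|}(X,Y)$ is the set of all norm-attaining $T\in\mathcal{L}(X,Y)$ with $\|T\|=1$ such that for every $\varepsilon>0$ there is $\eta(\varepsilon,T)>0$ such that whenever $x\in S_X$ satisfies $\|T(x)\|>1-\eta(\varepsilon,T)$, there is $x_0\in S_X$ with $\|T(x_0)\|=1$ and $\|x_0-x\|<\varepsilon$. $\mathcal{A}_{\mathrm{nu}}(X)$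 is the set of all numerical radius attaining $T\in\mathcal{L}(X)$ with $\nu(T)=1$ such that for every $\varepsilon>0$ there is $\eta(\varepsilon,T)>0$ such that whenever $(x,x^* )\in\Pi(X)$ satisfies $|\langle x^*,T(x)\rangle|>1-\eta(\varepsilon,T)$, there is $(x_0,x_0^* )\in\Pi(X)$ with $|\langle x_0^*,T(x_0)\rangle|=1$, $\|x_0-x\|<\varepsilon$ and $\|x_0^*-x^*\|<\varepsilon$. *)

theory Defs
  imports "HOL-Analysis.Analysis"
begin

section \<open>Normed spaces over the real or complex field\<close>

text \<open>
  The scalar field is a type of sort \<open>{real_normed_field, euclidean_space}\<close>, that is, a
  finite-dimensional commutative real division algebra with a multiplicative norm. The types
  \<^typ>\<open>real\<close> and \<^typ>\<open>complex\<close> are instances, and by Frobenius' theorem every type of this sort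
  is isometrically isomorphic to one of them.

  The classes for normed spaces only provide real scalars. The scalar multiplication is therefore
  an explicit parameter, required to extend the real one and to be compatible with the norm.
\<close>

locale scalar_normed_space = vector_space sX
  for sX :: "'k::{real_normed_field,euclidean_space} \<Rightarrow> 'a::real_normed_vector \<Rightarrow> 'a" +
  assumes scale_of_real: "sX (of_real r) x = r *\<^sub>R x"
    and norm_scale: "norm (sX c x) = norm c * norm x"

locale scalar_banach_space = scalar_normed_space sX
  for sX :: "'k::{real_normed_field,euclidean_space} \<Rightarrow> 'a::banach \<Rightarrow> 'a"

definition finite_dimensional ::
    "('k::{real_normed_field,euclidean_space} \<Rightarrow> 'a::real_normed_vector \<Rightarrow> 'a) \<Rightarrow> bool" where
  "finite_dimensional sX \<longleftrightarrow> (\<exists>B. finite_dimensional_vector_space sX B)"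

text \<open>
  \<^typ>\<open>'a \<Rightarrow>\<^sub>L 'b\<close> consists of the bounded \<^emph>\<open>real\<close>-linear maps with the operator norm;
  linearity over the scalar field is imposed separately.
\<close>

definition operators ::
    "('k::{real_normed_field,euclidean_space} \<Rightarrow> 'a::real_normed_vector \<Rightarrow> 'a) \<Rightarrow>
     ('k \<Rightarrow> 'b::real_normed_vector \<Rightarrow> 'b) \<Rightarrow> ('a \<Rightarrow>\<^sub>L 'b) set" where
  "operators sX sY = {T. Vector_Spaces.linear sX sY (blinfun_apply T)}"

abbreviation dual ::
    "('k::{real_normed_field,euclidean_space} \<Rightarrow> 'a::real_normed_vector \<Rightarrow> 'a) \<Rightarrow>
     ('a \<Rightarrow>\<^sub>L 'k) set" where
  "dual sX \<equiv> operators sX (*)"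


section \<open>Norm and numerical radius attainment\<close>

definition attains_norm :: "('a::real_normed_vector \<Rightarrow>\<^sub>L 'b::real_normed_vector) \<Rightarrow> bool" where
  "attains_norm T \<longleftrightarrow> (\<exists>x0 \<in> sphere 0 1. norm (T x0) = norm T)"

definition A_norm ::
    "('k::{real_normed_field,euclidean_space} \<Rightarrow> 'a::real_normed_vector \<Rightarrow> 'a) \<Rightarrow>
     ('k \<Rightarrow> 'b::real_normed_vector \<Rightarrow> 'b) \<Rightarrow> ('a \<Rightarrow>\<^sub>L 'b) set" where
  "A_norm sX sY = {T \<in> operators sX sY. attains_norm T \<and> norm T = 1 \<and>
     (\<forall>\<epsilon>>0. \<exists>\<eta>>0. \<forall>x \<in> sphere 0 1. norm (T x) > 1 - \<eta> \<longrightarrow>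
        (\<exists>x0 \<in> sphere 0 1. norm (T x0) = 1 \<and> norm (x0 - x) < \<epsilon>))}"

definition state_pairs ::
    "('k::{real_normed_field,euclidean_space} \<Rightarrow> 'a::real_normed_vector \<Rightarrow> 'a) \<Rightarrow>
     ('a \<times> ('a \<Rightarrow>\<^sub>L 'k)) set" where
  "state_pairs sX =
     {(x, f). x \<in> sphere 0 1 \<and> f \<in> dual sX \<and> f \<in> sphere 0 1 \<and> blinfun_apply f x = 1}"

text \<open>
  On the zero space there are no state pairs. The supremum of nonnegative numbers is then taken
  to be \<open>0\<close>, since \<^term>\<open>Sup {} :: real\<close> has no specified value.
\<close>

definition numerical_radius ::
    "('k::{real_normed_field,euclidean_space} \<Rightarrow> 'a::real_normed_vector \<Rightarrow> 'a) \<Rightarrow>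
     ('a \<Rightarrow>\<^sub>L 'a) \<Rightarrow> real" where
  "numerical_radius sX T =
     (if state_pairs sX = {} then 0
      else (SUP (x, f) \<in> state_pairs sX. norm (blinfun_apply f (T x))))"

definition attains_numerical_radius ::
    "('k::{real_normed_field,euclidean_space} \<Rightarrow> 'a::real_normed_vector \<Rightarrow> 'a) \<Rightarrow>
     ('a \<Rightarrow>\<^sub>L 'a) \<Rightarrow> bool" where
  "attains_numerical_radius sX T \<longleftrightarrow>
     (\<exists>(x, f) \<in> state_pairs sX. norm (blinfun_apply f (T x)) = numerical_radius sX T)"

definition A_nu ::
    "('k::{real_normed_field,euclidean_space} \<Rightarrow> 'a::real_normed_vector \<Rightarrow> 'a) \<Rightarrow>
     ('a \<Rightarrow>\<^sub>L 'a) set" where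
  "A_nu sX = {T \<in> operators sX sX. attains_numerical_radius sX T \<and> numerical_radius sX T = 1 \<and>
     (\<forall>\<epsilon>>0. \<exists>\<eta>>0. \<forall>(x, f) \<in> state_pairs sX. norm (blinfun_apply f (T x)) > 1 - \<eta> \<longrightarrow>
        (\<exists>(x0, f0) \<in> state_pairs sX. norm (blinfun_apply f0 (T x0)) = 1 \<and>
           norm (x0 - x) < \<epsilon> \<and> norm (f0 - f) < \<epsilon>))}"


section \<open>The space of null sequences\<close>

typedef (overloaded) 'k c0 = "{f :: nat \<Rightarrow> 'k::real_normed_vector. f \<longlonglongrightarrow> 0}"
  morphisms c0_nth Abs_c0
  by (rule exI[of _ "\<lambda>_. 0"]) simp

setup_lifting type_definition_c0

lemma c0_nth_tendsto: "c0_nth x \<longlonglongrightarrow> 0"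
  using c0_nth[of x] by simp

lemma c0_eqI: "(\<And>n. c0_nth x n = c0_nth y n) \<Longrightarrow> x = y"
  by (metis c0_nth_inject ext)

instantiation c0 :: (real_normed_vector) real_vector
begin

lift_definition zero_c0 :: "'a c0" is "\<lambda>_. 0" by simp
lift_definition plus_c0 :: "'a c0 \<Rightarrow> 'a c0 \<Rightarrow> 'a c0" is "\<lambda>f g n. f n + g n"
  using tendsto_add by fastforce
lift_definition minus_c0 :: "'a c0 \<Rightarrow> 'a c0 \<Rightarrow> 'a c0" is "\<lambda>f g n. f n - g n"
  using tendsto_diff by fastforce
lift_definition uminus_c0 :: "'a c0 \<Rightarrow> 'a c0" is "\<lambda>f n. - f n"
  using tendsto_minus by fastforce
lift_definition scaleR_c0 :: "real \<Rightarrow> 'a c0 \<Rightarrow> 'a c0" is "\<lambda>r f n. r *\<^sub>R f n"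
  using tendsto_scaleR[OF tendsto_const] by fastforce

instance
proof
  fix x y z :: "'a c0" and a b :: real
  show "x + y + z = x + (y + z)" by transfer (simp add: add.assoc)
  show "x + y = y + x" by transfer (simp add: add.commute)
  show "0 + x = x" by transfer simp
  show "- x + x = 0" by transfer simp
  show "x - y = x + - y" by transfer simp
  show "a *\<^sub>R (x + y) = a *\<^sub>R x + a *\<^sub>R y" by transfer (simp add: scaleR_add_right)
  show "(a + b) *\<^sub>R x = a *\<^sub>R x + b *\<^sub>R x" by transfer (simp add: scaleR_add_left)
  show "a *\<^sub>R b *\<^sub>R x = (a * b) *\<^sub>R x" by transfer simp
  show "1 *\<^sub>R x = x" by transfer simp
qed

end

instantiation c0 :: (real_normed_vector) real_normed_vector
begin

definition norm_c0 :: "'a c0 \<Rightarrow> real" where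
  "norm_c0 x = (SUP n. norm (c0_nth x n))"
definition dist_c0 :: "'a c0 \<Rightarrow> 'a c0 \<Rightarrow> real" where
  "dist_c0 x y = norm (x - y)"
definition sgn_c0 :: "'a c0 \<Rightarrow> 'a c0" where
  "sgn_c0 x = x /\<^sub>R norm x"
definition uniformity_c0 :: "('a c0 \<times> 'a c0) filter" where
  "uniformity_c0 = (INF e\<in>{0<..}. principal {(x, y). dist x y < e})"
definition open_c0 :: "'a c0 set \<Rightarrow> bool" where
  "open_c0 U = (\<forall>x\<in>U. eventually (\<lambda>(x', y). x' = x \<longrightarrow> y \<in> U) uniformity)"

lemma bdd_above_c0: "bdd_above (range (\<lambda>n. norm (c0_nth x n)))" for x :: "'a c0"
proof -
  have "Bseq (c0_nth x)"
    using c0_nth_tendsto convergentI convergent_imp_Bseq by blast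
  then obtain K where "\<forall>n. norm (c0_nth x n) \<le> K"
    unfolding Bseq_def by blast
  then show ?thesis by (intro bdd_aboveI2) auto
qed

lemma norm_c0_nth_le: "norm (c0_nth x n) \<le> norm x" for x :: "'a c0"
  unfolding norm_c0_def by (rule cSUP_upper[OF UNIV_I bdd_above_c0])

lemma norm_c0_leI: "(\<And>n. norm (c0_nth x n) \<le> b) \<Longrightarrow> norm x \<le> b" for x :: "'a c0"
  unfolding norm_c0_def by (rule cSUP_least) auto

instance
proof
  fix x y :: "'a c0" and a :: real
  show "dist x y = norm (x - y)" by (fact dist_c0_def)
  show "sgn x = x /\<^sub>R norm x" by (fact sgn_c0_def)
  show "uniformity = (INF e\<in>{0<..}. principal {(x, y :: 'a c0). dist x y < e})"
    by (fact uniformity_c0_def)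
  show "open U = (\<forall>x\<in>U. eventually (\<lambda>(x', y). x' = x \<longrightarrow> y \<in> U) uniformity)"
    for U :: "'a c0 set"
    by (fact open_c0_def)
  show "norm x = 0 \<longleftrightarrow> x = 0"
  proof
    assume "norm x = 0"
    then have "norm (c0_nth x n) \<le> 0" for n by (metis norm_c0_nth_le)
    then show "x = 0" by (intro c0_eqI) (simp add: zero_c0.rep_eq)
  qed (simp add: norm_c0_def zero_c0.rep_eq)
  show "norm (x + y) \<le> norm x + norm y"
    by (rule norm_c0_leI)
      (metis add_mono norm_c0_nth_le norm_triangle_le plus_c0.rep_eq)
  have le: "norm (r *\<^sub>R u) \<le> \<bar>r\<bar> * norm u" for r :: real and u :: "'a c0"
    by (rule norm_c0_leI) (simp add: scaleR_c0.rep_eq mult_left_mono norm_c0_nth_le)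
  show "norm (a *\<^sub>R x) = \<bar>a\<bar> * norm x"
  proof (cases "a = 0")
    case True
    have "c0_nth (a *\<^sub>R x) = (\<lambda>_. 0)" using True by (simp add: zero_c0.rep_eq)
    then show ?thesis using True by (simp add: norm_c0_def)
  next
    case False
    have "x = inverse a *\<^sub>R a *\<^sub>R x"
      using False by transfer simp
    then have "norm x \<le> \<bar>inverse a\<bar> * norm (a *\<^sub>R x)" by (metis le)
    then have "\<bar>a\<bar> * norm x \<le> norm (a *\<^sub>R x)"
      using False by (simp add: field_simps)
    with le[of a x] show ?thesis by simp
  qed
qed

end

instance c0 :: (banach) banach
proof
  fix X :: "nat \<Rightarrow> 'a c0"
  assume X: "Cauchy X"
  have nth_le: "norm (c0_nth (X i) n - c0_nth (X j) n) \<le> norm (X i - X j)" for i j n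
    by (metis minus_c0.rep_eq norm_c0_nth_le)
  have "Cauchy (\<lambda>i. c0_nth (X i) n)" for n
  proof (rule CauchyI)
    fix e :: real assume "e > 0"
    then obtain M where "\<forall>i\<ge>M. \<forall>j\<ge>M. norm (X i - X j) < e"
      using CauchyD[OF X] by blast
    then show "\<exists>M. \<forall>i\<ge>M. \<forall>j\<ge>M. norm (c0_nth (X i) n - c0_nth (X j) n) < e"
      using nth_le le_less_trans by blast
  qed
  then have "\<exists>y. (\<lambda>i. c0_nth (X i) n) \<longlonglongrightarrow> y" for n
    using Cauchy_convergent convergent_def by blast
  then obtain l where l: "(\<lambda>i. c0_nth (X i) n) \<longlonglongrightarrow> l n" for n
    by metis
  have unif: "\<exists>M. \<forall>i\<ge>M. \<forall>n. norm (c0_nth (X i) n - l n) \<le> e" if e: "e > 0" for e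
  proof -
    obtain M where M: "\<forall>i\<ge>M. \<forall>j\<ge>M. norm (X i - X j) < e"
      using CauchyD[OF X e] by blast
    have "norm (c0_nth (X i) n - l n) \<le> e" if "i \<ge> M" for i n
    proof (rule Lim_bounded)
      show "(\<lambda>j. norm (c0_nth (X i) n - c0_nth (X j) n)) \<longlonglongrightarrow> norm (c0_nth (X i) n - l n)"
        by (intro tendsto_intros l)
      show "\<forall>j\<ge>M. norm (c0_nth (X i) n - c0_nth (X j) n) \<le> e"
        using M that nth_le by (meson le_less_trans less_imp_le)
    qed
    then show ?thesis by blast
  qed
  have "l \<longlonglongrightarrow> 0"
  proof (rule LIMSEQ_I)
    fix e :: real assume e: "e > 0"
    then obtain M where M: "\<And>n. norm (c0_nth (X M) n - l n) \<le> e / 2"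
      using unif[of "e / 2"] by auto
    obtain N where N: "\<forall>n\<ge>N. norm (c0_nth (X M) n - 0) < e / 2"
      using LIMSEQ_D[OF c0_nth_tendsto, of "e / 2" "X M"] e by auto
    have "norm (l n - 0) < e" if "n \<ge> N" for n
    proof -
      have "norm (l n) \<le> norm (c0_nth (X M) n) + norm (c0_nth (X M) n - l n)"
        by (metis norm_minus_commute norm_triangle_sub)
      moreover have "norm (c0_nth (X M) n) < e / 2" using N that by simp
      ultimately show ?thesis using M[of n] by simp
    qed
    then show "\<exists>N. \<forall>n\<ge>N. norm (l n - 0) < e" by blast
  qed
  then have nth_L: "c0_nth (Abs_c0 l) = l"
    by (simp add: Abs_c0_inverse)
  have "X \<longlonglongrightarrow> Abs_c0 l"
  proof (rule LIMSEQ_I)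
    fix e :: real assume e: "e > 0"
    then obtain M where M: "\<And>i n. i \<ge> M \<Longrightarrow> norm (c0_nth (X i) n - l n) \<le> e / 2"
      using unif[of "e / 2"] by auto
    have "norm (X i - Abs_c0 l) \<le> e / 2" if "i \<ge> M" for i
      by (rule norm_c0_leI) (use M[OF that] in \<open>simp add: minus_c0.rep_eq nth_L\<close>)
    then show "\<exists>M. \<forall>i\<ge>M. norm (X i - Abs_c0 l) < e"
      using e by (intro exI[of _ M]) (smt (verit) field_sum_of_halves)
  qed
  then show "convergent X" unfolding convergent_def by blast
qed

lift_definition scale_c0 :: "'k::real_normed_field \<Rightarrow> 'k c0 \<Rightarrow> 'k c0" is "\<lambda>c f n. c * f n"
  using tendsto_mult[OF tendsto_const] by fastforce


section \<open>The standard structures are Banach spaces\<close>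

lemma scalar_banach_space_scalars:
  "scalar_banach_space ((*) :: 'k::{real_normed_field,euclidean_space} \<Rightarrow> 'k \<Rightarrow> 'k)"
  by unfold_locales (simp_all add: algebra_simps norm_mult scaleR_conv_of_real)

lemma scalar_banach_space_c0:
  "scalar_banach_space (scale_c0 :: 'k::{real_normed_field,euclidean_space} \<Rightarrow> 'k c0 \<Rightarrow> 'k c0)"
proof
  fix a b c :: 'k and x y :: "'k c0" and r :: real
  show "scale_c0 a (x + y) = scale_c0 a x + scale_c0 a y" by transfer (simp add: algebra_simps)
  show "scale_c0 (a + b) x = scale_c0 a x + scale_c0 b x" by transfer (simp add: algebra_simps)
  show assoc: "scale_c0 a (scale_c0 b x) = scale_c0 (a * b) x" for a b x
    by transfer (simp add: algebra_simps)
  show one: "scale_c0 1 x = x" for x by transfer simp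
  show "scale_c0 (of_real r) x = r *\<^sub>R x" by transfer (simp add: scaleR_conv_of_real)
  have le: "norm (scale_c0 c u) \<le> norm c * norm u" for c :: 'k and u
    by (rule norm_c0_leI) (simp add: scale_c0.rep_eq norm_mult mult_left_mono norm_c0_nth_le)
  show "norm (scale_c0 c x) = norm c * norm x"
  proof (cases "c = 0")
    case True
    then show ?thesis using le[of c x] by simp
  next
    case False
    have "x = scale_c0 (inverse c) (scale_c0 c x)"
      using False by (simp add: assoc one)
    then have "norm x \<le> norm (inverse c) * norm (scale_c0 c x)" by (metis le)
    then have "norm c * norm x \<le> norm c * (norm (inverse c) * norm (scale_c0 c x))"
      by (rule mult_left_mono) simp
    also have "\<dots> = norm (scale_c0 c x)"
      using False by (simp add: norm_inverse)
    finally have "norm c * norm x \<le> norm (scale_c0 c x)" .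
    with le[of c x] show ?thesis by simp
  qed
qed

end

theory Submission
  imports Defs
begin

text \<open>
  In parts (i) and (ii) the unit sphere of \<open>X\<close> and the set of state pairs are compact, and a
  continuous function stays away from its maximum off any neighbourhood of the maximum set.
  In part (iii), if \<open>f\<close> attains its norm at \<open>x\<^sub>0\<close>, then \<open>f\<close> vanishes on every \<open>z\<close> supported on
  the cofinite set where \<open>x\<^sub>0\<close> is smaller than \<open>1/2\<close>: after scaling, \<open>x\<^sub>0 + z\<close> and \<open>x\<^sub>0 - z\<close> are
  both in the unit ball, so the parallelogram law in the scalars forces \<open>f z = 0\<close>. Hence \<open>f\<close>
  depends on finitely many coordinates only, and compactness applies again.
\<close>

section \<open>Compactness in finite dimension\<close>

text \<open>Induction on \<open>B\<close>. If the new vector \<open>b\<close> lies outside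
  \<open>span B\<close>, its distance to \<open>span B\<close> is positive, which bounds the
  coefficients of \<open>b\<close> along the sequence. One subsequence makes these coefficients
  converge, and the induction hypothesis handles the remainders in \<open>span B\<close>.\<close>

lemma finite_span_convergent_subseq:
  fixes x :: "nat \<Rightarrow> 'a::real_normed_vector"
  assumes "finite B" "range x \<subseteq> span B" "bounded (range x)"
  shows "\<exists>l\<in>span B. \<exists>r. strict_mono (r :: nat \<Rightarrow> nat) \<and> (x \<circ> r) \<longlonglongrightarrow> l"
  using assms
proof (induction B arbitrary: x rule: finite_induct)
  case empty
  then have "x = (\<lambda>_. 0)" by auto
  then show ?case by (auto intro!: exI[of _ id] strict_mono_id)
next
  case (insert b B)
  show ?case
  proof (cases "b \<in> span B")
    case True
    then show ?thesis using insert.IH insert.prems by (simp add: span_redundant)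
  next
    case False
    \<comment> \<open>A convergent sequence in \<open>span B\<close> is bounded, so by the induction
      hypothesis some subsequence has its limit in \<open>span B\<close>; limits are unique.\<close>
    have "closed (span B)"
      unfolding closed_sequential_limits
    proof (intro allI impI, elim conjE)
      fix u l assume u: "\<forall>n. u n \<in> span B" "u \<longlonglongrightarrow> l"
      then obtain l' r where "l' \<in> span B" "strict_mono (r :: nat \<Rightarrow> nat)" "(u \<circ> r) \<longlonglongrightarrow> l'"
        using insert.IH[of u] convergent_imp_bounded by blast
      then show "l \<in> span B"
        using LIMSEQ_unique LIMSEQ_subseq_LIMSEQ[OF u(2)] by blast
    qed
    then have d: "infdist b (span B) > 0"
      using False infdist_pos_not_in_closed span_zero by blast
    have "\<exists>k. x n - k *\<^sub>R b \<in> span B" for n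
      using insert.prems(1) span_breakdown_eq[of "x n" b B] by blast
    then obtain c where c: "\<And>n. x n - c n *\<^sub>R b \<in> span B" by metis
    obtain M where M: "\<And>n. norm (x n) \<le> M"
      using insert.prems(2) by (auto simp: bounded_iff)
    have "norm (c n) \<le> M / infdist b (span B)" for n
    proof (cases "c n = 0")
      case True
      then show ?thesis
        using order_trans[OF norm_ge_zero M[of n]] d by simp
    next
      case False
      \<comment> \<open>This point of \<open>span B\<close> differs from \<open>b\<close> by exactly
        \<open>x n\<close> divided by \<open>c n\<close>.\<close>
      have "- ((1 / c n) *\<^sub>R (x n - c n *\<^sub>R b)) \<in> span B"
        by (intro span_neg span_scale c)
      then have "infdist b (span B) \<le> dist b (- ((1 / c n) *\<^sub>R (x n - c n *\<^sub>R b)))"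
        by (rule infdist_le)
      also have "\<dots> = norm (x n) / \<bar>c n\<bar>"
        using False by (simp add: dist_norm algebra_simps)
      finally show ?thesis
        using False d M[of n] by (simp add: field_simps)
    qed
    then have bc: "bounded (range c)" by (auto simp: bounded_iff)
    then obtain c0 r where r: "strict_mono (r :: nat \<Rightarrow> nat)" "(c \<circ> r) \<longlonglongrightarrow> c0"
      using bounded_imp_convergent_subsequence by blast
    define y where "y n = x (r n) - c (r n) *\<^sub>R b" for n
    have "bounded (range (\<lambda>n. x (r n)))"
      using insert.prems(2) by (rule bounded_subset) auto
    moreover have "bounded (range (\<lambda>n. c (r n) *\<^sub>R b))"
      using convergent_imp_bounded[OF tendsto_scaleR[OF r(2) tendsto_const[of b]]] by (simp add: o_def)
    ultimately have "bounded (range y)"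
      unfolding y_def by (rule bounded_minus_comp)
    moreover have "range y \<subseteq> span B" using c by (auto simp: y_def)
    ultimately obtain l s where s: "l \<in> span B" "strict_mono (s :: nat \<Rightarrow> nat)" "(y \<circ> s) \<longlonglongrightarrow> l"
      using insert.IH by blast
    have "(\<lambda>n. c (r (s n)) *\<^sub>R b + y (s n)) \<longlonglongrightarrow> c0 *\<^sub>R b + l"
      using LIMSEQ_subseq_LIMSEQ[OF r(2) s(2)] s(3) by (intro tendsto_intros) (auto simp: o_def)
    then have "(x \<circ> (r \<circ> s)) \<longlonglongrightarrow> c0 *\<^sub>R b + l" by (simp add: y_def o_def)
    moreover have "c0 *\<^sub>R b + l \<in> span (insert b B)"
      using s(1) by (auto simp: span_breakdown_eq intro!: exI[of _ c0])
    ultimately show ?thesis using strict_mono_o[OF r(1) s(2)] by blast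
  qed
qed

lemma bounded_sphere_metric: "bounded (sphere (a :: 'a::metric_space) r)"
  by (rule bounded_subset[OF bounded_cball sphere_cball])

lemma closed_sphere_metric: "closed (sphere (a :: 'a::metric_space) r)"
  unfolding sphere_def by (intro closed_Collect_eq continuous_intros)

lemma compact_finite_span:
  fixes S :: "'a::real_normed_vector set"
  assumes "finite B" "S \<subseteq> span B" "bounded S" "closed S"
  shows "compact S"
  unfolding compact_def
proof (intro allI impI)
  fix x :: "nat \<Rightarrow> 'a" assume x: "\<forall>n. x n \<in> S"
  then have "range x \<subseteq> span B" "bounded (range x)"
    using assms bounded_subset[OF assms(3)] by blast+
  then obtain l r where "strict_mono (r :: nat \<Rightarrow> nat)" "(x \<circ> r) \<longlonglongrightarrow> l"
    using finite_span_convergent_subseq[OF assms(1)] by blast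
  moreover have "l \<in> S"
    using closed_sequentially[OF assms(4) _ calculation(2)] x by simp
  ultimately show "\<exists>l\<in>S. \<exists>r. strict_mono r \<and> (x \<circ> r) \<longlonglongrightarrow> l" by blast
qed

section \<open>Compactness of sets of bounded linear maps\<close>

text \<open>Subsequences are extracted successively, one point of \<open>B\<close> at a time. For
  linear maps and a spanning set \<open>B\<close>, the convergence then spreads to every
  point.\<close>

lemma finite_pointwise_convergent_subseq:
  fixes g :: "nat \<Rightarrow> 'a \<Rightarrow> 'b::heine_borel"
  assumes "finite B" "\<And>b. b \<in> B \<Longrightarrow> bounded (range (\<lambda>n. g n b))"
  shows "\<exists>r. strict_mono (r :: nat \<Rightarrow> nat) \<and> (\<forall>b\<in>B. convergent (\<lambda>n. g (r n) b))"
  using assms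
proof (induction B rule: finite_induct)
  case empty
  show ?case by (auto intro!: exI[of _ id] strict_mono_id)
next
  case (insert b B)
  then obtain r where r: "strict_mono (r :: nat \<Rightarrow> nat)" "\<forall>b\<in>B. convergent (\<lambda>n. g (r n) b)"
    by auto
  have "bounded (range (\<lambda>n. g (r n) b))"
    using insert.prems[of b] by (auto intro: bounded_subset)
  then obtain l s where s: "strict_mono (s :: nat \<Rightarrow> nat)" "((\<lambda>n. g (r n) b) \<circ> s) \<longlonglongrightarrow> l"
    using bounded_imp_convergent_subsequence by blast
  have "convergent (\<lambda>n. g ((r \<circ> s) n) a)" if "a \<in> insert b B" for a
  proof (cases "a = b")
    case True
    then show ?thesis using s(2) by (auto simp: convergent_def o_def)
  next
    case False
    then have "convergent (\<lambda>n. g (r n) a)" using that r(2) by blast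
    then show ?thesis using convergent_subseq_convergent[OF _ s(1)] by (fastforce simp: o_def)
  qed
  then show ?case using strict_mono_o[OF r(1) s(1)] by blast
qed

lemma blinfun_pointwise_limit:
  fixes f :: "nat \<Rightarrow> 'a::real_normed_vector \<Rightarrow>\<^sub>L 'b::real_normed_vector"
  assumes "\<And>n. norm (f n) \<le> M" "\<And>x. (\<lambda>n. f n x) \<longlonglongrightarrow> g x"
  shows "\<exists>h. blinfun_apply h = g"
proof -
  have "bounded_linear g"
  proof (rule bounded_linear_intro[where K = M])
    show "g (x + y) = g x + g y" for x y
      using tendsto_add[OF assms(2)[of x] assms(2)[of y]] assms(2)[of "x + y"]
      by (simp add: blinfun.add_right LIMSEQ_unique)
    show "g (c *\<^sub>R x) = c *\<^sub>R g x" for c x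
      using tendsto_scaleR[OF tendsto_const[of c] assms(2)[of x]] assms(2)[of "c *\<^sub>R x"]
      by (simp add: blinfun.scaleR_right LIMSEQ_unique)
    have "norm (f n x) \<le> norm x * M" for n x
      using norm_blinfun[of "f n" x] mult_right_mono[OF assms(1)[of n] norm_ge_zero[of x]]
      by (simp add: mult.commute)
    then show "norm (g x) \<le> norm x * M" for x
      by (intro Lim_bounded[OF tendsto_norm[OF assms(2)[of x]]]) auto
  qed
  then show ?thesis using bounded_linear_Blinfun_apply by blast
qed

text \<open>The uniform norm bound makes the maps equi-Lipschitz. Convergence on a finite net of the
  compact ball is uniform on that net, and the common Lipschitz constant carries it to the whole
  sphere.\<close>

lemma blinfun_tendsto_of_pointwise:
  fixes f :: "nat \<Rightarrow> 'a::real_normed_vector \<Rightarrow>\<^sub>L 'b::real_normed_vector"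
    and g :: "'a \<Rightarrow>\<^sub>L 'b"
  assumes ball: "compact (cball 0 1 :: 'a set)"
    and bd: "\<And>n. norm (f n) \<le> M" and lim: "\<And>x. (\<lambda>n. f n x) \<longlonglongrightarrow> g x"
  shows "f \<longlonglongrightarrow> g"
proof (rule LIMSEQ_I)
  fix e :: real assume e: "e > 0"
  \<comment> \<open>\<open>L\<close> is a common Lipschitz constant for all differences
    \<open>f n - g\<close>.\<close>
  define L where "L = M + norm g"
  have "M \<ge> 0" using bd[of 0] norm_ge_zero order_trans by blast
  then have L: "L \<ge> 0" by (simp add: L_def)
  have dL: "norm (f n - g) \<le> L" for n
    using norm_triangle_ineq4[of "f n" g] bd[of n] by (simp add: L_def)
  \<comment> \<open>The mesh \<open>d\<close> makes the Lipschitz error at most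
    \<open>e / 4\<close>; the summand 1 keeps the quotient meaningful when \<open>L\<close> is 0.
    With the net error \<open>e / 4\<close> the total is \<open>e / 2\<close>, so the final
    inequality is strict.\<close>
  define d where "d = e / (4 * (L + 1))"
  have d: "d > 0" "L * d \<le> e / 4" using e L by (auto simp: d_def field_simps)
  have cover: "cball 0 1 \<subseteq> (\<Union>x\<in>cball (0 :: 'a) 1. ball x d)" using d(1) by auto
  obtain N where N: "N \<subseteq> cball (0 :: 'a) 1" "finite N" "cball 0 1 \<subseteq> (\<Union>x\<in>N. ball x d)"
    by (rule compactE_image[OF ball _ cover, OF open_ball])
  have "\<forall>x\<in>N. \<forall>\<^sub>F n in sequentially. norm (f n x - g x) < e / 4"
    using tendstoD[OF lim, of "e / 4"] e by (simp add: dist_norm)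
  then have "\<forall>\<^sub>F n in sequentially. \<forall>x\<in>N. norm (f n x - g x) < e / 4"
    using N(2) by (simp only: eventually_ball_finite_distrib)
  then obtain n0 where n0: "\<And>n x. n \<ge> n0 \<Longrightarrow> x \<in> N \<Longrightarrow> norm (f n x - g x) < e / 4"
    by (auto simp: eventually_sequentially)
  have "norm (f n - g) < e" if n: "n \<ge> n0" for n
  proof -
    have unit: "norm ((f n - g) x) \<le> e / 2" if x: "norm x = 1" for x
    proof -
      obtain y where y: "y \<in> N" "norm (x - y) < d"
      proof -
        have "x \<in> (\<Union>y\<in>N. ball y d)" by (rule subsetD[OF N(3)]) (simp add: x)
        then show ?thesis using that by (auto simp: dist_norm norm_minus_commute)
      qed
      have "norm ((f n - g) (x - y)) \<le> L * d"
        using norm_blinfun[of "f n - g" "x - y"] mult_mono[OF dL[of n] less_imp_le[OF y(2)]] L by simp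
      moreover have "norm ((f n - g) y) < e / 4"
        using n0[OF n y(1)] by (simp add: blinfun.diff_left)
      moreover have "norm ((f n - g) x) \<le> norm ((f n - g) (x - y)) + norm ((f n - g) y)"
        using norm_triangle_ineq[of "(f n - g) (x - y)" "(f n - g) y"]
        by (simp flip: blinfun.add_right)
      ultimately show ?thesis using d(2) by linarith
    qed
    have "norm (f n - g) \<le> e / 2"
    proof (rule norm_blinfun_bound)
      show "0 \<le> e / 2" using e by simp
      show "norm ((f n - g) x) \<le> e / 2 * norm x" for x
      proof (cases "x = 0")
        case False
        then show ?thesis
          using unit[of "x /\<^sub>R norm x"] by (simp add: blinfun.scaleR_right field_simps)
      qed (simp add: blinfun.zero_right)
    qed
    then show ?thesis using e by simp
  qed
  then show "\<exists>n0. \<forall>n\<ge>n0. norm (f n - g) < e" by blast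
qed

text \<open>A bounded sequence has a subsequence converging on \<open>B\<close>, hence pointwise
  everywhere by linearity. The pointwise limit is a bounded linear map, and compactness of the unit
  ball upgrades the convergence to the operator norm.\<close>

lemma compact_blinfun:
  fixes S :: "('a::real_normed_vector \<Rightarrow>\<^sub>L 'b::euclidean_space) set"
  assumes B: "finite B" "span B = (UNIV :: 'a set)" and "bounded S" "closed S"
  shows "compact S"
  unfolding compact_def
proof (intro allI impI)
  fix f :: "nat \<Rightarrow> 'a \<Rightarrow>\<^sub>L 'b" assume f: "\<forall>n. f n \<in> S"
  obtain M where M: "\<And>n. norm (f n) \<le> M"
    using \<open>bounded S\<close> f by (auto simp: bounded_iff)
  have "norm (f n x) \<le> M * norm x" for n x
    using norm_blinfun[of "f n" x] mult_right_mono[OF M[of n] norm_ge_zero[of x]] by simp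
  then have "bounded (range (\<lambda>n. f n x))" for x by (auto simp: bounded_iff)
  then obtain r where r: "strict_mono (r :: nat \<Rightarrow> nat)" "\<forall>b\<in>B. convergent (\<lambda>n. f (r n) b)"
    using finite_pointwise_convergent_subseq[OF B(1), of "\<lambda>n. blinfun_apply (f n)"] by blast
  \<comment> \<open>The points of convergence form a subspace containing \<open>B\<close>, hence the
    whole space.\<close>
  have "subspace {x. convergent (\<lambda>n. f (r n) x)}"
    by (intro subspaceI)
      (auto simp: blinfun.zero_right blinfun.add_right blinfun.scaleR_right convergent_const
        intro: convergent_add bounded_linear.convergent[OF bounded_linear_scaleR_right])
  then have "span B \<subseteq> {x. convergent (\<lambda>n. f (r n) x)}"
    using r(2) by (intro span_minimal) auto
  then have "\<forall>x. \<exists>l. (\<lambda>n. f (r n) x) \<longlonglongrightarrow> l"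
    using B(2) by (auto simp: convergent_def)
  then obtain g where g: "\<And>x. (\<lambda>n. f (r n) x) \<longlonglongrightarrow> g x" by metis
  then obtain h where h: "blinfun_apply h = g"
    using blinfun_pointwise_limit[of "f \<circ> r" M g] M by auto
  have "compact (cball 0 1 :: 'a set)"
    using compact_finite_span[OF B(1)] B(2) by auto
  then have lim: "(f \<circ> r) \<longlonglongrightarrow> h"
    by (rule blinfun_tendsto_of_pointwise[where M = M]) (use M g h in auto)
  moreover have "h \<in> S"
    using closed_sequentially[OF \<open>closed S\<close> _ lim] f by simp
  ultimately show "\<exists>h\<in>S. \<exists>r. strict_mono r \<and> (f \<circ> r) \<longlonglongrightarrow> h" using r(1) by blast
qed

section \<open>Near-maximisers on compact sets\<close>

text \<open>Removing from \<open>K\<close> the open \<open>e\<close>-balls around the points of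
  value \<open>m\<close> leaves a compact set, on which the maximum of \<open>g\<close> is below
  \<open>m\<close>; the gap serves as \<eta>. Here \<open>m\<close> is only an upper bound: if it is
  not attained, the conclusion says that \<open>g\<close> stays away from \<open>m\<close>. Thus
  values arbitrarily close to \<open>m\<close> force attainment.\<close>

lemma compact_near_max:
  fixes g :: "'a::metric_space \<Rightarrow> real"
  assumes "compact K" "continuous_on K g" "\<And>x. x \<in> K \<Longrightarrow> g x \<le> m" "e > 0"
  shows "\<exists>\<eta>>0. \<forall>x\<in>K. g x > m - \<eta> \<longrightarrow> (\<exists>x0\<in>K. g x0 = m \<and> dist x0 x < e)"
proof -
  define C where "C = K - (\<Union>x0\<in>{x0\<in>K. g x0 = m}. ball x0 e)"
  have "compact C" unfolding C_def by (intro compact_diff assms open_UN) auto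
  show ?thesis
  proof (cases "C = {}")
    case True
    \<comment> \<open>Every point of \<open>K\<close> is within \<open>e\<close> of a maximiser, so
      any positive \<eta> works.\<close>
    then show ?thesis by (intro exI[of _ 1]) (fastforce simp: C_def)
  next
    case False
    have "C \<subseteq> K" by (auto simp: C_def)
    then obtain z where z: "z \<in> C" "\<And>x. x \<in> C \<Longrightarrow> g x \<le> g z"
      using continuous_attains_sup[OF \<open>compact C\<close> False] continuous_on_subset[OF assms(2)] by blast
    have "g z \<noteq> m" using z(1) \<open>e > 0\<close> by (auto simp: C_def)
    then have "m - g z > 0" using assms(3)[of z] z(1) \<open>C \<subseteq> K\<close> by force
    moreover have "\<exists>x0\<in>K. g x0 = m \<and> dist x0 x < e" if "x \<in> K" "g x > m - (m - g z)" for x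
      using that z(2)[of x] by (force simp: C_def)
    ultimately show ?thesis by blast
  qed
qed

section \<open>Restriction of scalars and compactness of the state pairs\<close>

text \<open>Restriction of scalars: the products of a real basis of the field with a basis of the
  space over that field span the space over the reals.\<close>

lemma finite_dimensional_real_span:
  fixes sX :: "'k::{real_normed_field,euclidean_space} \<Rightarrow> 'a::real_normed_vector \<Rightarrow> 'a"
  assumes "scalar_normed_space sX" "finite_dimensional sX"
  shows "\<exists>B. finite B \<and> span B = (UNIV :: 'a set)"
proof -
  interpret X: scalar_normed_space sX by fact
  obtain B where "finite_dimensional_vector_space sX B"
    using assms(2) unfolding finite_dimensional_def by blast
  then interpret F: finite_dimensional_vector_space sX B .
  define B' where "B' = (\<lambda>(e, b). sX e b) ` (Basis \<times> B)"
  have "sX c b \<in> span B'" if b: "b \<in> B" for c b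
  proof -
    have "sX c b = sX (\<Sum>e\<in>Basis. (c \<bullet> e) *\<^sub>R e) b" by (simp add: euclidean_representation)
    also have "\<dots> = (\<Sum>e\<in>Basis. sX ((c \<bullet> e) *\<^sub>R e) b)" by (rule X.scale_sum_left)
    also have "\<dots> = (\<Sum>e\<in>Basis. (c \<bullet> e) *\<^sub>R sX e b)"
      by (simp add: scaleR_conv_of_real X.scale_of_real flip: X.scale_scale)
    also have "\<dots> \<in> span B'"
      using b by (intro span_sum span_scale span_base) (auto simp: B'_def)
    finally show ?thesis .
  qed
  then have "x \<in> span B'" for x
    using F.span_Basis X.span_finite[OF F.finite_Basis]
    by (metis (no_types, lifting) UNIV_I imageE span_sum)
  moreover have "finite B'" by (simp add: B'_def F.finite_Basis)
  ultimately show ?thesis by blast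
qed

lemma compact_sphere_finite_dimensional:
  fixes sX :: "'k::{real_normed_field,euclidean_space} \<Rightarrow> 'a::real_normed_vector \<Rightarrow> 'a"
  assumes "scalar_normed_space sX" "finite_dimensional sX"
  shows "compact (sphere 0 1 :: 'a set)"
  using finite_dimensional_real_span[OF assms]
    compact_finite_span[OF _ _ bounded_sphere_metric closed_sphere_metric]
  by (metis subset_UNIV)

text \<open>Additivity is built into bounded real-linear maps. What remains are the homogeneity
  equations, one for each scalar and vector, and each is a closed condition because evaluation is
  continuous.\<close>

lemma closed_operators:
  fixes sX :: "'k::{real_normed_field,euclidean_space} \<Rightarrow> 'a::real_normed_vector \<Rightarrow> 'a"
    and sY :: "'k \<Rightarrow> 'b::real_normed_vector \<Rightarrow> 'b"
  assumes X: "scalar_normed_space sX" and Y: "scalar_normed_space sY"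
  shows "closed (operators sX sY)"
proof -
  interpret X: scalar_normed_space sX by fact
  interpret Y: scalar_normed_space sY by fact
  have "bounded_linear (sY c)" for c
    by (rule bounded_linear_intro[where K = "norm c"])
      (simp_all add: Y.scale_right_distrib Y.norm_scale mult.commute flip: Y.scale_of_real)
  note cont = bounded_linear.continuous_on[OF this]
  have "operators sX sY = (\<Inter>c. \<Inter>x. {T. blinfun_apply T (sX c x) = sY c (blinfun_apply T x)})"
    unfolding operators_def Vector_Spaces.linear_def module_hom_def module_hom_axioms_def
    using X.vector_space_axioms Y.vector_space_axioms X.module_axioms Y.module_axioms
    by (auto simp: blinfun.add_right module_hom_axioms_def module_hom_def)
  moreover have "closed {T. blinfun_apply T (sX c x) = sY c (blinfun_apply T x)}" for c x
    by (intro closed_Collect_eq continuous_intros cont)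
  ultimately show ?thesis by (simp add: closed_INT)
qed

text \<open>The state pairs are cut out of the product of two compact spheres by closed conditions:
  linearity over the scalar field and the value 1 of the jointly continuous pairing.\<close>

lemma compact_state_pairs:
  fixes sX :: "'k::{real_normed_field,euclidean_space} \<Rightarrow> 'a::real_normed_vector \<Rightarrow> 'a"
  assumes "scalar_normed_space sX" "finite_dimensional sX"
  shows "compact (state_pairs sX)"
proof -
  obtain B where "finite B" "span B = (UNIV :: 'a set)"
    using finite_dimensional_real_span[OF assms] by blast
  then have "compact (sphere 0 1 :: ('a \<Rightarrow>\<^sub>L 'k) set)"
    by (rule compact_blinfun[OF _ _ bounded_sphere_metric closed_sphere_metric])
  then have "compact ((sphere 0 1 :: 'a set) \<times> (sphere 0 1 :: ('a \<Rightarrow>\<^sub>L 'k) set))"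
    by (intro compact_Times compact_sphere_finite_dimensional[OF assms])
  moreover have "closed (UNIV \<times> dual sX \<inter> {p. blinfun_apply (snd p) (fst p) = 1})"
    using scalar_banach_space_scalars[where 'k = 'k]
    by (intro closed_Int closed_Times closed_UNIV closed_operators[OF assms(1)]
          closed_Collect_eq continuous_intros) (simp add: scalar_banach_space_def)
  ultimately have "compact (sphere 0 1 \<times> sphere 0 1 \<inter>
      (UNIV \<times> dual sX \<inter> {p. blinfun_apply (snd p) (fst p) = 1}))"
    by (rule compact_Int_closed)
  moreover have "state_pairs sX = sphere 0 1 \<times> sphere 0 1 \<inter>
      (UNIV \<times> dual sX \<inter> {p. blinfun_apply (snd p) (fst p) = 1})"
    by (auto simp: state_pairs_def)
  ultimately show ?thesis by simp
qed

section \<open>The equalities in (i) and (ii)\<close>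

lemma blinfun_near_norm_on_sphere:
  fixes T :: "'a::real_normed_vector \<Rightarrow>\<^sub>L 'b::real_normed_vector"
  assumes "norm T = 1" "d > 0"
  shows "\<exists>x\<in>sphere 0 1. norm (T x) > 1 - d"
proof (rule ccontr)
  assume "\<not> ?thesis"
  then have le: "norm (T x) \<le> 1 - d" if "norm x = 1" for x using that by force
  \<comment> \<open>The maximum keeps the bound nonnegative when \<open>d\<close> exceeds 1, and
    still below 1. The argument also covers a space without unit vectors.\<close>
  have "norm T \<le> max 0 (1 - d)"
  proof (rule norm_blinfun_bound)
    show "norm (T x) \<le> max 0 (1 - d) * norm x" for x
    proof (cases "x = 0")
      case False
      then have "norm (T (x /\<^sub>R norm x)) \<le> max 0 (1 - d)"
        using le[of "x /\<^sub>R norm x"] by simp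
      then show ?thesis using False by (simp add: blinfun.scaleR_right field_simps)
    qed (simp add: blinfun.zero_right)
  qed simp
  then show False using assms by simp
qed

lemma A_norm_finite_dimensional:
  fixes sX :: "'k::{real_normed_field,euclidean_space} \<Rightarrow> 'a::real_normed_vector \<Rightarrow> 'a"
    and sY :: "'k \<Rightarrow> 'b::real_normed_vector \<Rightarrow> 'b"
  assumes "scalar_normed_space sX" "finite_dimensional sX"
  shows "A_norm sX sY = {T \<in> operators sX sY. norm T = 1}"
proof (intro subset_antisym subsetI)
  fix T assume "T \<in> {T \<in> operators sX sY. norm T = 1}"
  then have T: "T \<in> operators sX sY" "norm T = 1" by auto
  have near: "\<exists>\<eta>>0. \<forall>x\<in>sphere 0 1. norm (T x) > 1 - \<eta> \<longrightarrow>
      (\<exists>x0\<in>sphere 0 1. norm (T x0) = 1 \<and> dist x0 x < e)" if "e > 0" for e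
  proof (intro compact_near_max compact_sphere_finite_dimensional[OF assms] continuous_intros that)
    show "norm (T x) \<le> 1" if "x \<in> sphere 0 1" for x
      using norm_blinfun[of T x] T(2) that by simp
  qed
  \<comment> \<open>The radius 1 is arbitrary: unit vectors with values close to 1 exist, so some
    unit vector has value exactly 1.\<close>
  have "attains_norm T"
    using near[of 1] blinfun_near_norm_on_sphere[OF T(2)] T(2) unfolding attains_norm_def by fastforce
  then show "T \<in> A_norm sX sY" using near T by (simp add: A_norm_def dist_norm)
qed (simp add: A_norm_def)

lemma A_nu_finite_dimensional:
  fixes sX :: "'k::{real_normed_field,euclidean_space} \<Rightarrow> 'a::real_normed_vector \<Rightarrow> 'a"
  assumes "scalar_normed_space sX" "finite_dimensional sX"
  shows "A_nu sX = {T \<in> operators sX sX. numerical_radius sX T = 1}"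
proof (intro subset_antisym subsetI)
  fix T assume "T \<in> {T \<in> operators sX sX. numerical_radius sX T = 1}"
  then have T: "T \<in> operators sX sX" "numerical_radius sX T = 1" by auto
  define g where "g p = norm (blinfun_apply (snd p) (T (fst p)))" for p :: "'a \<times> ('a \<Rightarrow>\<^sub>L 'k)"
  \<comment> \<open>Radius 1 rules out the empty case, where the radius is 0 by convention.\<close>
  have ne: "state_pairs sX \<noteq> {}" and sup: "(SUP p\<in>state_pairs sX. g p) = 1"
    using T(2) by (auto simp: numerical_radius_def g_def case_prod_beta split: if_splits)
  have cont: "continuous_on (state_pairs sX) g"
    unfolding g_def by (intro continuous_intros)
  then have bdd: "bdd_above (g ` state_pairs sX)"
    by (intro bounded_imp_bdd_above compact_imp_bounded compact_continuous_image
        compact_state_pairs[OF assms])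
  have near: "\<exists>\<eta>>0. \<forall>p\<in>state_pairs sX. g p > 1 - \<eta> \<longrightarrow>
      (\<exists>p0\<in>state_pairs sX. g p0 = 1 \<and> dist p0 p < e)" if "e > 0" for e
    using that cSUP_upper[OF _ bdd] sup
    by (intro compact_near_max compact_state_pairs[OF assms] cont) auto
  \<comment> \<open>Attainment again comes from near-maximisers with an arbitrary radius; these
    exist because the supremum is 1.\<close>
  obtain \<eta> where \<eta>: "\<eta> > 0" "\<forall>p\<in>state_pairs sX. g p > 1 - \<eta> \<longrightarrow> (\<exists>p0\<in>state_pairs sX. g p0 = 1)"
    using near[of 1] by force
  then obtain p where "p \<in> state_pairs sX" "g p = 1"
    using less_cSUP_iff[OF ne bdd, of "1 - \<eta>"] sup by auto
  then have "attains_numerical_radius sX T"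
    using T(2) by (auto simp: attains_numerical_radius_def g_def)
  moreover have "\<exists>\<eta>>0. \<forall>(x, f)\<in>state_pairs sX. norm (blinfun_apply f (T x)) > 1 - \<eta> \<longrightarrow>
      (\<exists>(x0, f0)\<in>state_pairs sX. norm (blinfun_apply f0 (T x0)) = 1 \<and> norm (x0 - x) < e \<and> norm (f0 - f) < e)"
    if e: "e > 0" for e
  proof -
    obtain \<eta> where \<eta>: "\<eta> > 0" "\<forall>p\<in>state_pairs sX. g p > 1 - \<eta> \<longrightarrow>
        (\<exists>p0\<in>state_pairs sX. g p0 = 1 \<and> dist p0 p < e)"
      using near[OF e] by blast
    have "\<exists>(x0, f0)\<in>state_pairs sX. norm (blinfun_apply f0 (T x0)) = 1 \<and> norm (x0 - x) < e \<and> norm (f0 - f) < e"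
      if xf: "(x, f) \<in> state_pairs sX" "norm (blinfun_apply f (T x)) > 1 - \<eta>" for x f
    proof -
      obtain x0 f0 where p0: "(x0, f0) \<in> state_pairs sX" "g (x0, f0) = 1" "dist (x0, f0) (x, f) < e"
        using \<eta>(2) xf by (force simp: g_def)
      \<comment> \<open>The product distance dominates the distance in each component.\<close>
      have "norm (x0 - x) < e" "norm (f0 - f) < e"
        using p0(3) dist_fst_le[of "(x0, f0)" "(x, f)"] dist_snd_le[of "(x0, f0)" "(x, f)"]
        by (auto simp: dist_norm)
      then show ?thesis using p0 by (auto simp: g_def)
    qed
    then show ?thesis using \<eta>(1) by blast
  qed
  ultimately show "T \<in> A_nu sX" using T by (simp add: A_nu_def)
qed (simp add: A_nu_def)


section \<open>Functionals on the space of null sequences\<close>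

lift_definition c0_single :: "nat \<Rightarrow> 'k \<Rightarrow> 'k::real_normed_vector c0" is
  "\<lambda>n a m. if m = n then a else 0"
proof -
  fix n :: nat and a :: 'k
  show "(\<lambda>m. if m = n then a else 0) \<longlonglongrightarrow> 0"
    by (rule tendsto_eventually, rule eventually_sequentiallyI[of "Suc n"]) auto
qed

lift_definition c0_restrict :: "nat set \<Rightarrow> 'k::real_normed_vector c0 \<Rightarrow> 'k c0" is
  "\<lambda>F x n. if n \<in> F then x n else 0"
  by (rule Lim_null_comparison[OF _ tendsto_norm_zero]) auto

lemma bounded_linear_c0_nth: "bounded_linear (\<lambda>x. c0_nth x n)"
  by (rule bounded_linear_intro[where K = 1])
    (simp_all add: plus_c0.rep_eq scaleR_c0.rep_eq norm_c0_nth_le)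

text \<open>Sequences supported in \<open>F\<close> lie in the real span of finitely many coordinate
  vectors. The ball is taken instead of the sphere because truncating a unit vector to
  \<open>F\<close> can lower its norm.\<close>

lemma compact_c0_supported:
  assumes "finite F"
  shows "compact {z :: 'k::euclidean_space c0. norm z \<le> 1 \<and> (\<forall>n. n \<notin> F \<longrightarrow> c0_nth z n = 0)}"
    (is "compact ?K")
proof (rule compact_finite_span)
  let ?B = "(\<lambda>(n, e). c0_single n e) ` (F \<times> (Basis :: 'k set))"
  show "finite ?B" using assms by simp
  show "?K \<subseteq> span ?B"
  proof
    fix z assume z: "z \<in> ?K"
    have "z = (\<Sum>n\<in>F. \<Sum>e\<in>Basis. (c0_nth z n \<bullet> e) *\<^sub>R c0_single n e)"
    proof (rule c0_eqI)
      fix m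
      have "c0_nth (\<Sum>n\<in>F. \<Sum>e\<in>Basis. (c0_nth z n \<bullet> e) *\<^sub>R c0_single n e) m
          = (\<Sum>n\<in>F. \<Sum>e\<in>Basis. (c0_nth z n \<bullet> e) *\<^sub>R (if m = n then e else 0))"
        by (simp add: linear_sum[OF bounded_linear.linear[OF bounded_linear_c0_nth]]
            scaleR_c0.rep_eq c0_single.rep_eq)
      also have "\<dots> = (\<Sum>n\<in>F. if m = n then c0_nth z n else 0)"
        by (intro sum.cong) (auto simp: euclidean_representation)
      also have "\<dots> = c0_nth z m" using assms z by auto
      finally show "c0_nth z m = c0_nth (\<Sum>n\<in>F. \<Sum>e\<in>Basis. (c0_nth z n \<bullet> e) *\<^sub>R c0_single n e) m" ..
    qed
    also have "\<dots> \<in> span ?B" by (intro span_sum span_scale span_base) auto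
    finally show "z \<in> span ?B" .
  qed
  show "bounded ?K" by (auto simp: bounded_iff)
  have "?K = cball 0 1 \<inter> (\<Inter>n\<in>-F. {z. c0_nth z n = 0})" by auto
  also have "closed \<dots>"
    by (intro closed_Int closed_INT ballI closed_cball closed_Collect_eq continuous_intros
        bounded_linear.continuous_on[OF bounded_linear_c0_nth])
  finally show "closed ?K" .
qed

section \<open>Norm-attaining functionals on null sequences\<close>

lemma c0_attaining_finite_support:
  fixes f :: "'k::euclidean_space c0 \<Rightarrow>\<^sub>L 'b::real_inner"
  assumes "norm f = 1" "attains_norm f"
  shows "\<exists>F. finite F \<and> (\<forall>z. (\<forall>n\<in>F. c0_nth z n = 0) \<longrightarrow> f z = 0)"
proof -
  obtain x0 where x0: "norm x0 = 1" "norm (f x0) = 1"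
    using assms by (auto simp: attains_norm_def)
  \<comment> \<open>Off \<open>F\<close> the coordinates of \<open>x0\<close> leave room for a
    perturbation of size 1/2 inside the unit ball.\<close>
  define F where "F = {n. norm (c0_nth x0 n) \<ge> 1/2}"
  have "\<forall>\<^sub>F n in sequentially. norm (c0_nth x0 n) < 1/2"
    using c0_nth_tendsto[of x0] tendstoD[of "c0_nth x0" 0 _ "1/2"] by simp
  then obtain N where "\<And>n. n \<ge> N \<Longrightarrow> norm (c0_nth x0 n) < 1/2"
    by (auto simp: eventually_sequentially)
  then have "F \<subseteq> {..<N}" unfolding F_def by (force simp: not_le)
  then have "finite F" using finite_subset by blast
  moreover have "f z = 0" if z: "\<forall>n\<in>F. c0_nth z n = 0" for z
  proof -
    \<comment> \<open>The scaling gives norm at most 1/2; adding 1 avoids a separate case for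
      \<open>z\<close> equal to 0.\<close>
    define w where "w = (1 / (2 * (norm z + 1))) *\<^sub>R z"
    have pos: "2 * (norm z + 1) > 0" by (simp add: add_nonneg_pos)
    have "norm w \<le> 1/2" using pos by (simp add: w_def field_simps)
    then have w: "norm (c0_nth w n) \<le> 1/2" for n
      using norm_c0_nth_le order_trans by blast
    have wF: "c0_nth w n = 0" if "n \<in> F" for n
      using z that by (simp add: w_def scaleR_c0.rep_eq)
    have coord: "norm (c0_nth x0 n) + norm (c0_nth w n) \<le> 1" for n
      using wF[of n] w[of n] norm_c0_nth_le[of x0 n] x0(1) by (cases "n \<in> F") (auto simp: F_def)
    have "norm (x0 + w) \<le> 1"
      by (rule norm_c0_leI)
        (metis coord norm_triangle_ineq order_trans plus_c0.rep_eq)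
    moreover have "norm (x0 - w) \<le> 1"
      by (rule norm_c0_leI)
        (metis coord norm_triangle_ineq4 order_trans minus_c0.rep_eq)
    ultimately have "norm (f (x0 + w)) \<le> 1" "norm (f (x0 - w)) \<le> 1"
      using norm_blinfun[of f "x0 + w"] norm_blinfun[of f "x0 - w"] assms(1) by simp_all
    then have "(norm (f x0 + f w))\<^sup>2 \<le> 1" "(norm (f x0 - f w))\<^sup>2 \<le> 1"
      by (auto simp: blinfun.add_right blinfun.diff_right power_le_one)
    \<comment> \<open>The left side is at most 2, and \<open>f x0\<close> alone already contributes
      2 on the right, so nothing is left for \<open>f w\<close>.\<close>
    moreover have "(norm (f x0 + f w))\<^sup>2 + (norm (f x0 - f w))\<^sup>2 = 2 * (norm (f x0))\<^sup>2 + 2 * (norm (f w))\<^sup>2"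
      by (simp add: power2_norm_eq_inner algebra_simps inner_commute)
    moreover have "(norm (f x0))\<^sup>2 = 1" using x0(2) by simp
    ultimately have "(norm (f w))\<^sup>2 \<le> 0" by linarith
    then have "f w = 0" by simp
    then show ?thesis using pos by (simp add: w_def blinfun.scaleR_right)
  qed
  ultimately show ?thesis by blast
qed

text \<open>Since \<open>f\<close> sees only the coordinates in \<open>F\<close>, a near-maximiser
  is truncated to \<open>F\<close>, moved to a nearby maximiser in the compact set \<open>K\<close>,
  and given its old tail back. The supremum norm treats coordinates separately, so restoring the
  tail does not leave the unit ball.\<close>

lemma c0_attaining_near_max:
  fixes f :: "'k::euclidean_space c0 \<Rightarrow>\<^sub>L 'b::real_inner"
  assumes "norm f = 1" "attains_norm f" "e > 0"
  shows "\<exists>\<eta>>0. \<forall>x\<in>sphere 0 1. norm (f x) > 1 - \<eta> \<longrightarrow>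
           (\<exists>x0\<in>sphere 0 1. norm (f x0) = 1 \<and> norm (x0 - x) < e)"
proof -
  obtain F where F: "finite F" "\<forall>z. (\<forall>n\<in>F. c0_nth z n = 0) \<longrightarrow> f z = 0"
    using c0_attaining_finite_support[OF assms(1,2)] by blast
  define K where "K = {z :: 'k c0. norm z \<le> 1 \<and> (\<forall>n. n \<notin> F \<longrightarrow> c0_nth z n = 0)}"
  have f_le: "norm (f x) \<le> norm x" for x using norm_blinfun[of f x] assms(1) by simp
  have "compact K" unfolding K_def by (rule compact_c0_supported[OF F(1)])
  moreover have "norm (f z) \<le> 1" if "z \<in> K" for z
    using that f_le[of z] by (simp add: K_def)
  moreover have "continuous_on K (\<lambda>z. norm (f z))" by (intro continuous_intros)
  ultimately obtain \<eta> where \<eta>: "\<eta> > 0" "\<forall>z\<in>K. norm (f z) > 1 - \<eta> \<longrightarrow>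
      (\<exists>z0\<in>K. norm (f z0) = 1 \<and> dist z0 z < e)"
    using compact_near_max[of K "\<lambda>z. norm (f z)" 1 e] assms(3) by blast
  have "\<exists>x0\<in>sphere 0 1. norm (f x0) = 1 \<and> norm (x0 - x) < e"
    if x: "x \<in> sphere 0 1" "norm (f x) > 1 - \<eta>" for x
  proof -
    define p where "p = c0_restrict F x"
    have p: "c0_nth p n = (if n \<in> F then c0_nth x n else 0)" for n
      by (simp add: p_def c0_restrict.rep_eq)
    have x_le: "norm (c0_nth x n) \<le> 1" for n using norm_c0_nth_le[of x n] x(1) by simp
    have fp: "f (x - p) = 0" using F(2) by (simp add: minus_c0.rep_eq p)
    have "p \<in> K" unfolding K_def using norm_c0_leI[of p 1] x_le by (simp add: p)
    moreover have "norm (f p) > 1 - \<eta>" using x(2) fp by (simp add: blinfun.diff_right)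
    ultimately obtain z where z: "z \<in> K" "norm (f z) = 1" "norm (z - p) < e"
      using \<eta>(2) by (auto simp: dist_norm)
    \<comment> \<open>\<open>y\<close> agrees with \<open>z\<close> on \<open>F\<close> and with
      \<open>x\<close> elsewhere, so \<open>f y\<close> equals \<open>f z\<close>.\<close>
    define y where "y = z + (x - p)"
    have fy: "norm (f y) = 1" using z(2) fp by (simp add: y_def blinfun.add_right)
    have "norm (c0_nth y n) \<le> 1" for n
      using z(1) x_le[of n] order_trans[OF norm_c0_nth_le[of z n]]
      by (cases "n \<in> F") (simp_all add: y_def K_def plus_c0.rep_eq minus_c0.rep_eq p)
    then have "norm y \<le> 1" by (rule norm_c0_leI)
    \<comment> \<open>The lower bound comes from \<open>f\<close> having norm 1 and
      \<open>f y\<close> having norm 1.\<close>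
    then have "norm y = 1" using f_le[of y] fy by simp
    moreover have "y - x = z - p" by (simp add: y_def)
    ultimately show ?thesis using fy z(3) by (intro bexI[of _ y]) auto
  qed
  then show ?thesis using \<eta>(1) by blast
qed

theorem theorem2p1:
  fixes sX :: "'k::{real_normed_field,euclidean_space} \<Rightarrow> 'a::banach \<Rightarrow> 'a"
    and sY :: "'k \<Rightarrow> 'b::banach \<Rightarrow> 'b"
  shows "(scalar_banach_space sX \<and> finite_dimensional sX \<longrightarrow>
            (scalar_banach_space sY \<longrightarrow> A_norm sX sY = {T \<in> operators sX sY. norm T = 1}) \<and>
            A_nu sX = {T \<in> operators sX sX. numerical_radius sX T = 1}) \<and>
         (\<forall>f \<in> dual (scale_c0 :: 'k \<Rightarrow> 'k c0 \<Rightarrow> 'k c0).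
            norm f = 1 \<and> attains_norm f \<longrightarrow> f \<in> A_norm scale_c0 (*))"
  using A_norm_finite_dimensional[of sX sY] A_nu_finite_dimensional[of sX] c0_attaining_near_max
  by (auto simp: A_norm_def scalar_banach_space_def)

end
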